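(* Let $(S,N,Z)$ be a structured semigroup. Then the set $\mathcal{D}(S)$ of non-empty directed cosets is an ideal, and hence an étale subgroupoid (in the subspace topology), of the coset groupoid $\mathcal{C}(S)$.
   Context: A structured semigroup $(S,N,Z)$ consists of a semigroup $S$, a subsemigroup $N$ of $S$ and a subsemigroup $Z$ of $S$ with $Z\subseteq\mathsf{Z}(N)=\{z\in N:\forall n\in N\ (nz=zn)\}$, such that: (i) for all $a,b\in S$, $ab,ba\in Z$ implies $aZb\cup bZa\subseteq Z$; (ii) for all $a,b\in S$ and $n\in N$, if $abn=n=nab$ and $ab,ba\in Z$ then $bna\in N$. For $a,s,b\in S$: $a<_sb$ means $asb=a=bsa$, $as,sa\in N$ and $bs,sb\in Z$; $a<b$ means $a<_sb$ for some $s\in S$. For $A,B\subseteq S$: $AB=\{ab:a\in A,b\in B\}$, $A^<=\{b\in S:\exists a\in A\ (a<b)\}$ and $A^*=\{s\in S:\exists a\in A\,\exists b\in S\ (a<_sb)\}$. A coset is a $C\subseteq S$ with $CC^*C\subseteq C=C^<$. $\mathcal{C}(S)$ is the set of non-empty cosets; with $\mathsf{s}(C)=(C^*C)^<$ and $\mathsf{r}(C)=(CC^* )^<$, it is an étale groupoid with inverse $C\mapsto C^*$, product $B\cdot C=(BC)^<$ defined when $\mathsf{s}(B)=\mathsf{r}(C)$, and the topology with subbasis $\mathcal{C}_a=\{C\in\mathcal{C}(S):a\in C\}$, $a\in S$. (A topological groupoid is étale if its source map sends open subsets to open subsets of the groupoid; no Hausdorff assumption.) $D\subseteq S$ is directed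 if for all $a,b\in D$ there is $d\in D$ with $d<a$ and $d<b$. $\mathcal{D}(S)=\{D\in\mathcal{C}(S):D\text{ is directed}\}$. A subset $I$ of a groupoid $G$ is an ideal if, whenever $gh$ is defined and $g\in I$ or $h\in I$, we have $gh\in I$. *)

theory Defs
  imports "HOL-Analysis.Analysis" "HOL-Library.Set_Algebras"
begin

section \<open>Groupoids\<close>

text \<open>
  A groupoid is given by its set of arrows; units are identified with identity arrows.
  The function \<open>gmult\<close> is total, but \<open>gmult G g h\<close> is meaningful
  only on composable pairs, i.e. when \<open>src G g = rng G h\<close>.
\<close>

record 'g groupoid_data =
  arrows :: "'g set"
  src :: "'g \<Rightarrow> 'g"
  rng :: "'g \<Rightarrow> 'g"
  gmult :: "'g \<Rightarrow> 'g \<Rightarrow> 'g"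
  ginv :: "'g \<Rightarrow> 'g"

definition composable :: "'g groupoid_data \<Rightarrow> ('g \<times> 'g) set" where
  "composable G = {(g, h). g \<in> arrows G \<and> h \<in> arrows G \<and> src G g = rng G h}"

locale groupoid =
  fixes G :: "'g groupoid_data"
  assumes src_closed: "g \<in> arrows G \<Longrightarrow> src G g \<in> arrows G"
    and rng_closed: "g \<in> arrows G \<Longrightarrow> rng G g \<in> arrows G"
    and ginv_closed: "g \<in> arrows G \<Longrightarrow> ginv G g \<in> arrows G"
    and gmult_closed: "(g, h) \<in> composable G \<Longrightarrow> gmult G g h \<in> arrows G"
    and src_src: "g \<in> arrows G \<Longrightarrow> src G (src G g) = src G g"
    and rng_src: "g \<in> arrows G \<Longrightarrow> rng G (src G g) = src G g"
    and src_rng: "g \<in> arrows G \<Longrightarrow> src G (rng G g) = rng G g"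
    and rng_rng: "g \<in> arrows G \<Longrightarrow> rng G (rng G g) = rng G g"
    and src_gmult: "(g, h) \<in> composable G \<Longrightarrow> src G (gmult G g h) = src G h"
    and rng_gmult: "(g, h) \<in> composable G \<Longrightarrow> rng G (gmult G g h) = rng G g"
    and gmult_assoc: "\<lbrakk>(f, g) \<in> composable G; (g, h) \<in> composable G\<rbrakk>
      \<Longrightarrow> gmult G (gmult G f g) h = gmult G f (gmult G g h)"
    and gmult_src: "g \<in> arrows G \<Longrightarrow> gmult G g (src G g) = g"
    and gmult_rng: "g \<in> arrows G \<Longrightarrow> gmult G (rng G g) g = g"
    and src_ginv: "g \<in> arrows G \<Longrightarrow> src G (ginv G g) = rng G g"
    and rng_ginv: "g \<in> arrows G \<Longrightarrow> rng G (ginv G g) = src G g"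
    and gmult_ginv_left: "g \<in> arrows G \<Longrightarrow> gmult G (ginv G g) g = src G g"
    and gmult_ginv_right: "g \<in> arrows G \<Longrightarrow> gmult G g (ginv G g) = rng G g"

locale groupoid_ideal = groupoid G for G :: "'g groupoid_data" +
  fixes I :: "'g set"
  assumes ideal_subset: "I \<subseteq> arrows G"
    and ideal_gmult: "\<lbrakk>(g, h) \<in> composable G; g \<in> I \<or> h \<in> I\<rbrakk> \<Longrightarrow> gmult G g h \<in> I"

locale subgroupoid = groupoid G for G :: "'g groupoid_data" +
  fixes H :: "'g set"
  assumes sub_subset: "H \<subseteq> arrows G"
    and sub_gmult: "\<lbrakk>(g, h) \<in> composable G; g \<in> H; h \<in> H\<rbrakk> \<Longrightarrow> gmult G g h \<in> H"
    and sub_ginv: "g \<in> H \<Longrightarrow> ginv G g \<in> H"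

text \<open>
  Continuity of source and range follows from continuity of product and inverse.
\<close>

locale topological_groupoid = groupoid G for G :: "'g groupoid_data" +
  fixes T :: "'g topology"
  assumes topspace_eq: "topspace T = arrows G"
    and continuous_ginv: "continuous_map T T (ginv G)"
    and continuous_gmult: "continuous_map (subtopology (prod_topology T T) (composable G)) T
      (\<lambda>(g, h). gmult G g h)"

locale etale_groupoid = topological_groupoid +
  assumes open_src: "open_map T T (src G)"

locale etale_subgroupoid =
  topological_groupoid G T + subgroupoid G H +
  sub: etale_groupoid "G\<lparr>arrows := H\<rparr>" "subtopology T H"
  for G :: "'g groupoid_data" and T :: "'g topology" and H :: "'g set"


section \<open>Structured semigroups\<close>

definition subsemigroup :: "'a::semigroup_mult set \<Rightarrow> bool" where
  "subsemigroup A \<longleftrightarrow> (\<forall>a\<in>A. \<forall>b\<in>A. a * b \<in> A)"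

definition semigroup_centre :: "'a::semigroup_mult set \<Rightarrow> 'a set" where
  "semigroup_centre N = {z \<in> N. \<forall>n\<in>N. n * z = z * n}"

text \<open>The ambient semigroup \<open>S\<close> is the whole type.\<close>

locale structured_semigroup =
  fixes N Z :: "'a::semigroup_mult set"
  assumes subsemigroup_N: "subsemigroup N"
    and subsemigroup_Z: "subsemigroup Z"
    and Z_central: "Z \<subseteq> semigroup_centre N"
    and Z_conj: "\<lbrakk>a * b \<in> Z; b * a \<in> Z\<rbrakk> \<Longrightarrow> {a} * Z * {b} \<union> {b} * Z * {a} \<subseteq> Z"
    and N_conj: "\<lbrakk>n \<in> N; a * b * n = n; n = n * a * b; a * b \<in> Z; b * a \<in> Z\<rbrakk>
      \<Longrightarrow> b * n * a \<in> N"

text \<open>\<open>rel_below_by N Z s a b\<close> renders \<open>a <\<^sub>s b\<close>.\<close>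

definition rel_below_by :: "'a::semigroup_mult set \<Rightarrow> 'a set \<Rightarrow> 'a \<Rightarrow> 'a \<Rightarrow> 'a \<Rightarrow> bool" where
  "rel_below_by N Z s a b \<longleftrightarrow> a * s * b = a \<and> a = b * s * a \<and>
     a * s \<in> N \<and> s * a \<in> N \<and> b * s \<in> Z \<and> s * b \<in> Z"

definition rel_below :: "'a::semigroup_mult set \<Rightarrow> 'a set \<Rightarrow> 'a \<Rightarrow> 'a \<Rightarrow> bool" where
  "rel_below N Z a b \<longleftrightarrow> (\<exists>s. rel_below_by N Z s a b)"

definition up_closure :: "'a::semigroup_mult set \<Rightarrow> 'a set \<Rightarrow> 'a set \<Rightarrow> 'a set" where
  "up_closure N Z A = {b. \<exists>a\<in>A. rel_below N Z a b}"

definition star :: "'a::semigroup_mult set \<Rightarrow> 'a set \<Rightarrow> 'a set \<Rightarrow> 'a set" where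
  "star N Z A = {s. \<exists>a\<in>A. \<exists>b. rel_below_by N Z s a b}"

definition coset :: "'a::semigroup_mult set \<Rightarrow> 'a set \<Rightarrow> 'a set \<Rightarrow> bool" where
  "coset N Z C \<longleftrightarrow> C * star N Z C * C \<subseteq> C \<and> C = up_closure N Z C"

definition cosets :: "'a::semigroup_mult set \<Rightarrow> 'a set \<Rightarrow> 'a set set" where
  "cosets N Z = {C. coset N Z C \<and> C \<noteq> {}}"

definition coset_groupoid ::
    "'a::semigroup_mult set \<Rightarrow> 'a set \<Rightarrow> 'a set groupoid_data" where
  "coset_groupoid N Z =
    \<lparr>arrows = cosets N Z,
     src = (\<lambda>C. up_closure N Z (star N Z C * C)),
     rng = (\<lambda>C. up_closure N Z (C * star N Z C)),
     gmult = (\<lambda>B C. up_closure N Z (B * C)),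
     ginv = star N Z\<rparr>"

definition coset_topology ::
    "'a::semigroup_mult set \<Rightarrow> 'a set \<Rightarrow> 'a set topology" where
  "coset_topology N Z = topology_generated_by {{C \<in> cosets N Z. a \<in> C} |a. True}"

definition directed :: "'a::semigroup_mult set \<Rightarrow> 'a set \<Rightarrow> 'a set \<Rightarrow> bool" where
  "directed N Z D \<longleftrightarrow> (\<forall>a\<in>D. \<forall>b\<in>D. \<exists>d\<in>D. rel_below N Z d a \<and> rel_below N Z d b)"

definition directed_cosets :: "'a::semigroup_mult set \<Rightarrow> 'a set \<Rightarrow> 'a set set" where
  "directed_cosets N Z = {D \<in> cosets N Z. directed N Z D}"

end

theory Submission
  imports Defs
begin

text \<open>
  Read \<open>a <\<^sub>s b\<close> as: \<open>s\<close> inverts \<open>b\<close>, up to factors from \<open>Z\<close>, wherever \<open>a\<close> lives, and \<open>a\<close> is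
  \<open>b\<close> multiplied by an element of \<open>N\<close>. A guiding example is an abelian group with \<open>Z\<close> trivial and
  \<open>N\<close> a submonoid: there \<open>a <\<^sub>s b\<close> means that \<open>s\<close> is the inverse of \<open>b\<close> and \<open>a\<close> is in \<open>N b\<close>,
  and the non-empty cosets are the ordinary cosets of the subgroups containing \<open>N\<close>. The
  general proof imitates the computations with ordinary cosets. Inverses have to be
  restricted to smaller elements each time, and this is possible because every element of
  a coset has an element of the coset below it.

  Three properties of the relation carry the calculations: it is transitive
  (\<open>below_by_trans\<close>), it is compatible with products (\<open>below_by_mult\<close>), and multiplying the lower
  element by an element of \<open>N\<close> keeps it lower (\<open>below_by_N_left\<close>, \<open>below_by_N_right\<close>).

  The set \<open>C\<^sup>\<star>\<close> of local inverses of a coset \<open>C\<close> is a coset with \<open>C\<^sup>\<star>\<^sup>\<star> = C\<close>. The delicate point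
  is that \<open>C\<^sup>\<star>\<close> is closed upwards, because elements of \<open>N\<close> need not be invertible in \<open>N\<close>; the
  lemmas \<open>below_by_correction\<close> and \<open>below_by_corrected\<close> repair this inside \<open>C\<close>. The product of
  composable cosets is a coset because a local inverse of a product, multiplied by one factor, is a
  local inverse of the other (\<open>right_times_star\<close>). The identity
  \<open>(B \<cdot> C)\<^sup>\<star> = C\<^sup>\<star> \<cdot> B\<^sup>\<star>\<close> then follows from \<open>C\<^sup>\<star>\<^sup>\<star> = C\<close> by symmetry, and the groupoid laws are
  calculations with upward closures.

  Product and inverse are continuous because a statement \<open>a \<in> B \<cdot> C\<close> or \<open>a \<in> C\<^sup>\<star>\<close> is witnessed by
  finitely many elements of the cosets involved. The source map is open because a coset meeting \<open>N\<close> is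
  a unit (\<open>coset_meets_N_unit\<close>), and because a unit \<open>F\<close> close to the source of a coset through \<open>c\<close> is
  itself the source of a coset, the upward closure of \<open>c F\<close> (\<open>coset_with_source\<close>).

  Directedness passes from \<open>C\<close> to \<open>B \<cdot> C\<close>, since pairs in \<open>B\<close> can be reduced to a single element of
  \<open>B\<close> at the cost of moving an element of \<open>B\<^sup>\<star> B\<close> across to \<open>C\<close>. It passes from \<open>C\<close> to \<open>C\<^sup>\<star>\<close> as well,
  which gives the statement for the other factor. So the directed cosets form an ideal that is
  closed under inverses; and an ideal inherits the openness of the source map.
\<close>

section \<open>Groupoids\<close>

context groupoid
begin

lemma composable_srcI: "g \<in> arrows G \<Longrightarrow> (g, src G g) \<in> composable G"
  by (simp add: composable_def src_closed rng_src)

lemma composable_ginv_left: "g \<in> arrows G \<Longrightarrow> (ginv G g, g) \<in> composable G"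
  by (simp add: composable_def ginv_closed src_ginv)

lemma composable_ginv_right: "g \<in> arrows G \<Longrightarrow> (g, ginv G g) \<in> composable G"
  by (simp add: composable_def ginv_closed rng_ginv)

end

lemma (in subgroupoid) groupoid_restrict: "groupoid (G\<lparr>arrows := H\<rparr>)"
proof -
  have ar: "g \<in> arrows G" if "g \<in> H" for g using that sub_subset by blast
  have comp: "(g, h) \<in> composable G \<and> g \<in> H \<and> h \<in> H"
    if "(g, h) \<in> composable (G\<lparr>arrows := H\<rparr>)" for g h
    using that ar by (auto simp: composable_def)
  have s: "src G g \<in> H" if "g \<in> H" for g
    using sub_gmult[OF composable_ginv_left] that ar sub_ginv gmult_ginv_left by metis
  have r: "rng G g \<in> H" if "g \<in> H" for g
    using sub_gmult[OF composable_ginv_right] that ar sub_ginv gmult_ginv_right by metis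
  show ?thesis
    by unfold_locales
      (use s r comp ar sub_gmult sub_ginv in
        \<open>auto simp: src_src rng_src src_rng rng_rng src_gmult rng_gmult gmult_assoc gmult_src
          gmult_rng src_ginv rng_ginv gmult_ginv_left gmult_ginv_right\<close>)
qed

lemma topological_subgroupoid_restrict:
  assumes "topological_groupoid G T" "subgroupoid G H"
  shows "topological_groupoid (G\<lparr>arrows := H\<rparr>) (subtopology T H)"
proof -
  interpret topological_groupoid G T by fact
  interpret subgroupoid G H by fact
  interpret r: groupoid "G\<lparr>arrows := H\<rparr>" by (rule groupoid_restrict)
  have comp: "composable (G\<lparr>arrows := H\<rparr>) = (H \<times> H) \<inter> composable G"
    using sub_subset by (auto simp: composable_def)
  have top: "subtopology (prod_topology (subtopology T H) (subtopology T H))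
      (composable (G\<lparr>arrows := H\<rparr>))
    = subtopology (subtopology (prod_topology T T) (composable G)) (H \<times> H)"
    by (simp add: comp subtopology_subtopology flip: subtopology_Times) (simp add: Int_ac)
  show ?thesis
  proof
    show "topspace (subtopology T H) = arrows (G\<lparr>arrows := H\<rparr>)"
      using sub_subset topspace_eq by auto
    show "continuous_map (subtopology T H) (subtopology T H) (ginv (G\<lparr>arrows := H\<rparr>))"
      using sub_ginv
      by (auto simp: continuous_map_in_subtopology
          intro: continuous_map_from_subtopology continuous_ginv)
    show "continuous_map (subtopology (prod_topology (subtopology T H) (subtopology T H))
        (composable (G\<lparr>arrows := H\<rparr>))) (subtopology T H)
        (\<lambda>(g, h). gmult (G\<lparr>arrows := H\<rparr>) g h)"
      unfolding top continuous_map_in_subtopology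
      using sub_gmult
      by (auto intro!: continuous_map_from_subtopology[OF continuous_gmult, simplified])
  qed
qed

text \<open>An arrow whose source lies in an ideal is its product with that source and so lies in the
  ideal itself; the source map therefore satisfies \<open>src (U \<inter> I) = src U \<inter> I\<close>, which is what
  makes the restriction of an open source map to an ideal open again.\<close>

lemma etale_subgroupoid_ideal:
  assumes "etale_groupoid G T" "groupoid_ideal G I" "subgroupoid G I"
  shows "etale_subgroupoid G T I"
proof -
  interpret etale_groupoid G T by fact
  interpret groupoid_ideal G I by fact
  interpret subgroupoid G I by fact
  interpret r: topological_groupoid "G\<lparr>arrows := I\<rparr>" "subtopology T I"
    by (rule topological_subgroupoid_restrict) unfold_locales
  have ar: "g \<in> arrows G" if "g \<in> I" for g using that ideal_subset by blast
  have "open_map (subtopology T I) (subtopology T I) (src G)"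
    unfolding open_map_def
  proof (intro allI impI)
    fix V assume "openin (subtopology T I) V"
    then obtain U where U: "openin T U" "V = U \<inter> I" by (auto simp: openin_subtopology)
    have "U \<subseteq> arrows G" using U(1) openin_subset topspace_eq by blast
    then have "src G ` V = src G ` U \<inter> I"
      using U(2) r.src_closed ideal_gmult[OF composable_srcI] gmult_src by auto
    then show "openin (subtopology T I) (src G ` V)"
      using open_src U(1) by (auto simp: open_map_def openin_subtopology)
  qed
  then show ?thesis by unfold_locales simp_all
qed


section \<open>The calculus of the relation below\<close>

context structured_semigroup
begin

abbreviation below_by :: "'a \<Rightarrow> 'a \<Rightarrow> 'a \<Rightarrow> bool" ("_ \<lhd>[_] _" [51, 0, 51] 50) where
  "a \<lhd>[s] b \<equiv> rel_below_by N Z s a b"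

abbreviation below :: "'a \<Rightarrow> 'a \<Rightarrow> bool" (infix "\<lhd>" 50) where
  "a \<lhd> b \<equiv> rel_below N Z a b"

abbreviation up :: "'a set \<Rightarrow> 'a set" ("_\<^sup>\<up>" [1000] 999) where
  "A\<^sup>\<up> \<equiv> up_closure N Z A"

abbreviation starset :: "'a set \<Rightarrow> 'a set" ("_\<^sup>\<star>" [1000] 999) where
  "A\<^sup>\<star> \<equiv> star N Z A"

lemma N_mult: "m \<in> N \<Longrightarrow> n \<in> N \<Longrightarrow> m * n \<in> N"
  using subsemigroup_N by (simp add: subsemigroup_def)

lemma Z_mult: "y \<in> Z \<Longrightarrow> z \<in> Z \<Longrightarrow> y * z \<in> Z"
  using subsemigroup_Z by (simp add: subsemigroup_def)

lemma Z_imp_N: "z \<in> Z \<Longrightarrow> z \<in> N"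
  using Z_central by (auto simp: semigroup_centre_def)

lemma NZ_commute: "n \<in> N \<Longrightarrow> z \<in> Z \<Longrightarrow> n * z = z * n"
  using Z_central by (auto simp: semigroup_centre_def)

lemma Z_conjugate: "\<lbrakk>p * q \<in> Z; q * p \<in> Z; z \<in> Z\<rbrakk> \<Longrightarrow> p * z * q \<in> Z"
  using Z_conj[of p q] by (auto simp: subset_iff)

lemma N_conjugate:
  "\<lbrakk>p * q \<in> Z; q * p \<in> Z; n \<in> N; q * p * n = n; n * (q * p) = n\<rbrakk> \<Longrightarrow> p * n * q \<in> N"
  using N_conj[of n q p] by (simp add: mult.assoc)

lemma below_byI:
  "\<lbrakk>a * s * b = a; b * s * a = a; a * s \<in> N; s * a \<in> N; b * s \<in> Z; s * b \<in> Z\<rbrakk> \<Longrightarrow> a \<lhd>[s] b"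
  by (simp add: rel_below_by_def)

lemma below_byD:
  assumes "a \<lhd>[s] b"
  shows "a * s * b = a" "b * s * a = a" "a * s \<in> N" "s * a \<in> N" "b * s \<in> Z" "s * b \<in> Z"
  using assms by (simp_all add: rel_below_by_def)

lemma below_byD_assoc:
  assumes "a \<lhd>[s] b"
  shows "a * (s * b) = a" "b * (s * a) = a" "a * (s * (b * x)) = a * x" "b * (s * (a * x)) = a * x"
  using below_byD(1,2)[OF assms] by (metis mult.assoc)+

lemma below_by_imp_below: "a \<lhd>[s] b \<Longrightarrow> a \<lhd> b"
  by (auto simp: rel_below_def)

lemma below_by_trans:
  assumes "a \<lhd>[s] b" "b \<lhd>[t] c"
  shows "a \<lhd>[t] c"
proof (rule below_byI)
  note ab = below_byD_assoc[OF assms(1)] and bc = below_byD_assoc[OF assms(2)]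
  show "a * t * c = a" using ab bc by (metis mult.assoc)
  show "c * t * a = a" using ab bc by (metis mult.assoc)
  have "a * t = a * s * (b * t)" using ab by (simp add: mult.assoc)
  then show "a * t \<in> N" using below_byD[OF assms(1)] below_byD[OF assms(2)] N_mult by simp
  have "t * a = t * b * (s * a)" using ab by (simp add: mult.assoc)
  then show "t * a \<in> N" using below_byD[OF assms(1)] below_byD[OF assms(2)] N_mult by simp
qed (use below_byD[OF assms(2)] in auto)

lemma below_trans: "a \<lhd> b \<Longrightarrow> b \<lhd> c \<Longrightarrow> a \<lhd> c"
  unfolding rel_below_def using below_by_trans by blast

lemma below_by_mult:
  assumes ab: "a \<lhd>[s] b" and cd: "c \<lhd>[t] d"
  shows "a * c \<lhd>[t * s] b * d"
proof (rule below_byI)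
  note a = below_byD[OF ab] below_byD_assoc[OF ab] and c = below_byD[OF cd] below_byD_assoc[OF cd]
  have c1: "c * t * (s * b) = s * b * (c * t)" using a c NZ_commute by blast
  have c2: "s * a * (d * t) = d * t * (s * a)" using a c NZ_commute by blast
  have "a * c * (t * s) * (b * d) = a * (c * t * (s * b)) * d" by (simp add: mult.assoc)
  also have "\<dots> = a * c" unfolding c1 using a c by (simp add: mult.assoc)
  finally show "a * c * (t * s) * (b * d) = a * c" .
  have "b * d * (t * s) * (a * c) = b * (d * t * (s * a)) * c" by (simp add: mult.assoc)
  also have "\<dots> = a * c" unfolding c2[symmetric] using a c by (simp add: mult.assoc)
  finally show "b * d * (t * s) * (a * c) = a * c" .
  \<comment> \<open>Both products with \<open>t * s\<close> conjugate the element \<open>s * a * (c * t)\<close> of \<open>N\<close>.\<close>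
  have n: "s * a * (c * t) \<in> N" using a c N_mult by blast
  have n1: "s * a * (c * t) * (s * b) = s * a * (c * t)"
    by (metis a(1) c1 mult.assoc)
  have "b * (s * a * (c * t)) * s \<in> N"
    by (rule N_conjugate) (use a n n1 in \<open>simp_all add: mult.assoc\<close>)
  then show "a * c * (t * s) \<in> N" using a by (simp add: mult.assoc)
  have n2: "d * t * (s * a * (c * t)) = s * a * (c * t)"
    by (metis c(2) c2 mult.assoc)
  have "t * (s * a * (c * t)) * d \<in> N"
    by (rule N_conjugate) (use c n n2 in \<open>simp_all add: mult.assoc\<close>)
  then show "t * s * (a * c) \<in> N" using c by (simp add: mult.assoc)
  have "b * (d * t) * s \<in> Z" using a c by (intro Z_conjugate)
  then show "b * d * (t * s) \<in> Z" by (simp add: mult.assoc)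
  have "t * (s * b) * d \<in> Z" using a c by (intro Z_conjugate)
  then show "t * s * (b * d) \<in> Z" by (simp add: mult.assoc)
qed

lemma below_mult: "a \<lhd> b \<Longrightarrow> c \<lhd> d \<Longrightarrow> a * c \<lhd> b * d"
  unfolding rel_below_def using below_by_mult by blast

lemma below_by_N_left:
  assumes ab: "a \<lhd>[s] b" and n: "n \<in> N"
  shows "n * a \<lhd>[s] b"
proof (rule below_byI)
  note a = below_byD[OF ab] below_byD_assoc[OF ab]
  have c: "n * (b * s) = b * s * n" using a n NZ_commute by blast
  show "n * a * s * b = n * a" using a by (simp add: mult.assoc)
  have bsn: "b * s * (n * x) = n * (b * (s * x))" for x by (metis c mult.assoc)
  show "b * s * (n * a) = n * a" using a by (simp add: bsn)
  have m: "n * (a * s) \<in> N" using a n N_mult by blast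
  then show "n * a * s \<in> N" by (simp add: mult.assoc)
  have "s * (n * (a * s)) * b \<in> N"
    by (rule N_conjugate) (use a m in \<open>simp_all add: mult.assoc bsn[unfolded mult.assoc]\<close>)
  then show "s * (n * a) \<in> N" using a by (simp add: mult.assoc)
qed (use below_byD[OF ab] in auto)

lemma below_by_N_right:
  assumes ab: "a \<lhd>[s] b" and n: "n \<in> N"
  shows "a * n \<lhd>[s] b"
proof (rule below_byI)
  note a = below_byD[OF ab] below_byD_assoc[OF ab]
  have c: "n * (s * b) = s * b * n" using a n NZ_commute by blast
  show "b * s * (a * n) = a * n" using a by (simp add: mult.assoc)
  show "a * n * s * b = a * n" by (metis a(1) c mult.assoc)
  have m: "s * a * n \<in> N" using a n N_mult by blast
  then show "s * (a * n) \<in> N" by (simp add: mult.assoc)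
  have m1: "s * a * n * (s * b) = s * a * n" by (metis a(1) c mult.assoc)
  have "b * (s * a * n) * s \<in> N"
    by (rule N_conjugate) (use a m m1 in \<open>simp_all add: mult.assoc\<close>)
  then show "a * n * s \<in> N" using a by (simp add: mult.assoc)
qed (use below_byD[OF ab] in auto)

lemma below_N_left: "a \<lhd> b \<Longrightarrow> n \<in> N \<Longrightarrow> n * a \<lhd> b"
  unfolding rel_below_def using below_by_N_left by blast

lemma below_N_right: "a \<lhd> b \<Longrightarrow> n \<in> N \<Longrightarrow> a * n \<lhd> b"
  unfolding rel_below_def using below_by_N_right by blast

text \<open>Here \<open>s\<close> plays the part of an inverse of \<open>b\<close> near \<open>a\<close>, and \<open>s * a * s\<close> is its
  restriction to \<open>a\<close>. The lemma exchanges the roles of \<open>b\<close> and \<open>s\<close>.\<close>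

lemma below_by_dual:
  assumes "a \<lhd>[s] b"
  shows "s * a * s \<lhd>[b] s"
  by (rule below_byI) (use below_byD[OF assms] below_byD_assoc[OF assms] in \<open>simp_all add: mult.assoc\<close>)

text \<open>Together with the previous lemma, this shows that the inverses of the elements of a set that
  reaches below itself again reach below themselves.\<close>

lemma below_by_restricted_inverse:
  assumes ab: "a \<lhd>[w] b" and bc: "b \<lhd>[u] c"
  shows "a \<lhd>[u * b * u] c * w * c"
proof (rule below_byI)
  note a = below_byD[OF ab] below_byD_assoc[OF ab] and b = below_byD[OF bc] below_byD_assoc[OF bc]
  have c1: "b * u * (b * w) = b * w * (b * u)" using a b NZ_commute by blast
  have c2: "u * b * (w * b) = w * b * (u * b)" using a b NZ_commute by blast
  have "a * (u * b * u) * (c * w * c) = a * w * (b * u * (b * w)) * c"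
    using a b by (simp add: mult.assoc)
  also have "\<dots> = a"
    unfolding c1 using a b below_byD_assoc[OF below_by_trans[OF ab bc]] by (simp add: mult.assoc)
  finally show "a * (u * b * u) * (c * w * c) = a" .
  have "c * w * c * (u * b * u) * a = c * (w * b * (u * b)) * w * a"
    using a b by (simp add: mult.assoc)
  also have "\<dots> = a"
    unfolding c2[symmetric] using a b below_byD_assoc[OF below_by_trans[OF ab bc]]
    by (simp add: mult.assoc)
  finally show "c * w * c * (u * b * u) * a = a" .
  have au: "a * u \<in> N" "u * a \<in> N" using below_byD[OF below_by_trans[OF ab bc]] by auto
  then show "a * (u * b * u) \<in> N" "u * b * u * a \<in> N"
    using N_mult[of "a * u" "b * u"] N_mult[of "u * b" "u * a"] b by (simp_all add: mult.assoc)
  have "c * (w * b) * u \<in> Z" "u * (b * w) * c \<in> Z" using a b by (auto intro: Z_conjugate)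
  then show "c * w * c * (u * b * u) \<in> Z" "u * b * u * (c * w * c) \<in> Z"
    using b by (simp_all add: mult.assoc)
qed

text \<open>If \<open>s\<close> inverts \<open>b\<close> near \<open>a\<close> and \<open>r\<close> inverts \<open>t\<close> near \<open>s\<close>, then \<open>s\<close> and \<open>t\<close> may
  differ by a factor from \<open>N\<close> that has no inverse in \<open>N\<close>, so that \<open>t\<close> need not invert \<open>b\<close>
  near \<open>a\<close>. The next three lemmas correct \<open>a\<close> by this factor: \<open>a * s * r\<close> is the product
  of \<open>a\<close>, the inverse \<open>s * r * s\<close> of \<open>b * t * b\<close>, and \<open>b\<close>. In this form it stays in any
  coset through \<open>a\<close>.\<close>

lemma below_by_correction:
  assumes ab: "a \<lhd>[s] b" and st: "s \<lhd>[r] t"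
  shows "a \<lhd>[s * r * s] b * t * b"
proof (rule below_byI)
  note a = below_byD[OF ab] below_byD_assoc[OF ab] and s = below_byD[OF st] below_byD_assoc[OF st]
  have c1: "s * r * (s * b) = s * b * (s * r)" using a s NZ_commute by blast
  have c2: "r * s * (b * s) = b * s * (r * s)" using a s NZ_commute by blast
  have "a * (s * r * s) * (b * t * b) = a * (s * r * (s * b)) * t * b" by (simp add: mult.assoc)
  also have "\<dots> = a" unfolding c1 using a s by (simp add: mult.assoc)
  finally show "a * (s * r * s) * (b * t * b) = a" .
  have "b * t * b * (s * r * s) * a = b * t * (b * s * (r * s)) * a" by (simp add: mult.assoc)
  also have "\<dots> = a" unfolding c2[symmetric] using a s by (simp add: mult.assoc)
  finally show "b * t * b * (s * r * s) * a = a" .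
  show "a * (s * r * s) \<in> N" "s * r * s * a \<in> N"
    using N_mult[of "a * s" "r * s"] N_mult[of "s * r" "s * a"] a s by (simp_all add: mult.assoc)
  have "b * (t * (b * s) * r) * s \<in> Z" "s * (r * (s * b) * t) * b \<in> Z"
    using a s by (auto intro: Z_conjugate)
  then show "b * t * b * (s * r * s) \<in> Z" "s * r * s * (b * t * b) \<in> Z"
    by (simp_all add: mult.assoc)
qed

lemma correction_eq:
  assumes ab: "a \<lhd>[s] b" and st: "s \<lhd>[r] t"
  shows "a * (s * r * s) * b = a * s * r"
proof -
  have c: "s * r * (s * b) = s * b * (s * r)"
    using below_byD[OF ab] below_byD[OF st] NZ_commute by blast
  have "a * (s * r * s) * b = a * (s * r * (s * b))" by (simp add: mult.assoc)
  also have "\<dots> = a * s * r" unfolding c using below_byD_assoc[OF ab] by (simp add: mult.assoc)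
  finally show ?thesis .
qed

lemma below_by_corrected:
  assumes ab: "a \<lhd>[s] b" and st: "s \<lhd>[r] t"
  shows "a * s * r \<lhd>[t] r"
proof (rule below_byI)
  note a = below_byD[OF ab] below_byD_assoc[OF ab] and s = below_byD[OF st] below_byD_assoc[OF st]
  have c: "r * t * (b * s) = b * s * (r * t)" using a s NZ_commute Z_imp_N by blast
  have "r * t * a = r * t * (b * s) * a" using a by (simp add: mult.assoc)
  also have "\<dots> = a" unfolding c using a s by (simp add: mult.assoc)
  finally have rta: "r * t * a = a" .
  then have rta': "r * (t * (a * x)) = a * x" for x by (metis mult.assoc)
  show "a * s * r * t * r = a * s * r" using s by (simp add: mult.assoc)
  show "r * t * (a * s * r) = a * s * r" using rta' by (simp add: mult.assoc)
  show "a * s * r * t \<in> N" using a s by (simp add: mult.assoc)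
  have "t * (a * s) * r \<in> N"
    by (rule N_conjugate) (use a s rta' in \<open>simp_all add: mult.assoc\<close>)
  then show "t * (a * s * r) \<in> N" by (simp add: mult.assoc)
qed (use below_byD[OF st] in auto)

text \<open>An inverse of a product is an inverse of one factor once it is multiplied by the other. The
  next two lemmas, mirror images of each other, give the precise form of this.\<close>

lemma below_by_cancel_right:
  assumes bc: "b * c \<lhd>[s] y" and b: "b' \<lhd>[t] b" and c: "c' \<lhd>[u] c"
  shows "b' * c' * u \<lhd>[c * s] y * u"
proof (rule below_byI)
  have "b' * c' \<lhd>[s] y" by (rule below_by_trans[OF below_by_mult[OF b c] bc])
  note x = below_byD[OF this] below_byD_assoc[OF this, unfolded mult.assoc]
    and c = below_byD[OF c] below_byD_assoc[OF c]
  have com: "s * (b' * c') * (u * c) = u * c * (s * (b' * c'))" using x c NZ_commute by blast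
  have n: "s * (b' * c') * (u * c) = s * (b' * c')" using c by (simp add: mult.assoc)
  show "b' * c' * u * (c * s) * (y * u) = b' * c' * u" using x c by (simp add: mult.assoc)
  have "y * u * (c * s) * (b' * c' * u) = y * (u * c * (s * (b' * c'))) * u"
    by (simp add: mult.assoc)
  also have "\<dots> = b' * c' * u" unfolding com[symmetric] n using x by (simp add: mult.assoc)
  finally show "y * u * (c * s) * (b' * c' * u) = b' * c' * u" .
  show "b' * c' * u * (c * s) \<in> N" using x c by (simp add: mult.assoc)
  have "c * (s * (b' * c')) * u \<in> N" by (rule N_conjugate) (use x c n com in simp_all)
  then show "c * s * (b' * c' * u) \<in> N" by (simp add: mult.assoc)
  have "y * (u * c) * s \<in> Z" "c * (s * y) * u \<in> Z" using x c by (auto intro: Z_conjugate)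
  then show "y * u * (c * s) \<in> Z" "c * s * (y * u) \<in> Z" by (simp_all add: mult.assoc)
qed

lemma below_by_cancel_left:
  assumes bc: "b * c \<lhd>[s] y" and b: "b' \<lhd>[t] b" and c: "c' \<lhd>[u] c"
  shows "t * (b' * c') \<lhd>[s * b] t * y"
proof (rule below_byI)
  have "b' * c' \<lhd>[s] y" by (rule below_by_trans[OF below_by_mult[OF b c] bc])
  note x = below_byD[OF this] below_byD_assoc[OF this, unfolded mult.assoc]
    and b = below_byD[OF b] below_byD_assoc[OF b]
  have com: "b' * c' * s * (b * t) = b * t * (b' * c' * s)" using x b NZ_commute by blast
  have n: "b * t * (b' * c' * s) = b' * c' * s" using b by (simp add: mult.assoc)
  show "t * y * (s * b) * (t * (b' * c')) = t * (b' * c')" using x b by (simp add: mult.assoc)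
  have "t * (b' * c') * (s * b) * (t * y) = t * (b' * c' * s * (b * t)) * y"
    by (simp add: mult.assoc)
  also have "\<dots> = t * (b' * c')" unfolding com n using x by (simp add: mult.assoc)
  finally show "t * (b' * c') * (s * b) * (t * y) = t * (b' * c')" .
  show "s * b * (t * (b' * c')) \<in> N" using x b by (simp add: mult.assoc)
  have "t * (b' * c' * s) * b \<in> N" by (rule N_conjugate) (use x b n com in simp_all)
  then show "t * (b' * c') * (s * b) \<in> N" by (simp add: mult.assoc)
  have "s * (b * t) * y \<in> Z" "t * (y * s) * b \<in> Z" using x b by (auto intro: Z_conjugate)
  then show "s * b * (t * y) \<in> Z" "t * y * (s * b) \<in> Z" by (simp_all add: mult.assoc)
qed


section \<open>Upward closures and inverses of sets\<close>

lemma up_iff: "b \<in> A\<^sup>\<up> \<longleftrightarrow> (\<exists>a\<in>A. a \<lhd> b)"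
  by (simp add: up_closure_def)

lemma upI: "a \<in> A \<Longrightarrow> a \<lhd> b \<Longrightarrow> b \<in> A\<^sup>\<up>"
  by (auto simp: up_iff)

lemma up_mono: "A \<subseteq> B \<Longrightarrow> A\<^sup>\<up> \<subseteq> B\<^sup>\<up>"
  unfolding up_closure_def by blast

lemma obtain_below:
  assumes "A \<subseteq> A\<^sup>\<up>" "b \<in> A"
  obtains a u where "a \<in> A" "a \<lhd>[u] b"
  using subsetD[OF assms] by (auto simp: up_iff rel_below_def)

lemma up_up: "(A\<^sup>\<up>)\<^sup>\<up> \<subseteq> A\<^sup>\<up>"
  unfolding up_closure_def using below_trans by blast

lemma up_up_eq: "A \<subseteq> A\<^sup>\<up> \<Longrightarrow> (A\<^sup>\<up>)\<^sup>\<up> = A\<^sup>\<up>"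
  by (simp add: up_mono up_up subset_antisym)

lemma up_times_up: "A\<^sup>\<up> * B\<^sup>\<up> \<subseteq> (A * B)\<^sup>\<up>"
  unfolding up_closure_def by (blast elim: set_times_elim intro: below_mult)

lemma times_subset_up: "A \<subseteq> A\<^sup>\<up> \<Longrightarrow> B \<subseteq> B\<^sup>\<up> \<Longrightarrow> A * B \<subseteq> (A * B)\<^sup>\<up>"
  using up_times_up set_times_mono2 by blast

lemma up_up_times:
  assumes "A \<subseteq> A\<^sup>\<up>" "B \<subseteq> B\<^sup>\<up>"
  shows "(A\<^sup>\<up> * B)\<^sup>\<up> = (A * B)\<^sup>\<up>"
proof
  have "A\<^sup>\<up> * B \<subseteq> (A * B)\<^sup>\<up>" using up_times_up set_times_mono2[OF subset_refl assms(2)] by blast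
  then show "(A\<^sup>\<up> * B)\<^sup>\<up> \<subseteq> (A * B)\<^sup>\<up>" using up_mono up_up by blast
  show "(A * B)\<^sup>\<up> \<subseteq> (A\<^sup>\<up> * B)\<^sup>\<up>" using assms by (intro up_mono set_times_mono2) auto
qed

lemma up_times_up_right:
  assumes "A \<subseteq> A\<^sup>\<up>" "B \<subseteq> B\<^sup>\<up>"
  shows "(A * B\<^sup>\<up>)\<^sup>\<up> = (A * B)\<^sup>\<up>"
proof
  have "A * B\<^sup>\<up> \<subseteq> (A * B)\<^sup>\<up>" using up_times_up set_times_mono2[OF assms(1) subset_refl] by blast
  then show "(A * B\<^sup>\<up>)\<^sup>\<up> \<subseteq> (A * B)\<^sup>\<up>" using up_mono up_up by blast
  show "(A * B)\<^sup>\<up> \<subseteq> (A * B\<^sup>\<up>)\<^sup>\<up>" using assms by (intro up_mono set_times_mono2) auto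
qed

lemma up_times_up_times:
  assumes "A \<subseteq> A\<^sup>\<up>" "B \<subseteq> B\<^sup>\<up>" "C \<subseteq> C\<^sup>\<up>"
  shows "(A * B\<^sup>\<up> * C)\<^sup>\<up> = (A * B * C)\<^sup>\<up>"
proof -
  have "A * B\<^sup>\<up> \<subseteq> (A * B\<^sup>\<up>)\<^sup>\<up>" using assms by (intro times_subset_up) (simp_all add: up_up_eq)
  then have "(A * B\<^sup>\<up> * C)\<^sup>\<up> = ((A * B\<^sup>\<up>)\<^sup>\<up> * C)\<^sup>\<up>" using assms(3) by (rule up_up_times[symmetric])
  also have "\<dots> = (A * B * C)\<^sup>\<up>" using assms by (simp add: up_times_up_right up_up_times times_subset_up)
  finally show ?thesis .
qed

lemma starI: "a \<in> A \<Longrightarrow> a \<lhd>[s] b \<Longrightarrow> s \<in> A\<^sup>\<star>"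
  by (auto simp: star_def)

lemma starE:
  assumes "s \<in> A\<^sup>\<star>"
  obtains a b where "a \<in> A" "a \<lhd>[s] b"
  using assms by (auto simp: star_def)

lemma star_mono: "A \<subseteq> B \<Longrightarrow> A\<^sup>\<star> \<subseteq> B\<^sup>\<star>"
  by (auto simp: star_def)

lemma star_up: "A \<subseteq> A\<^sup>\<up> \<Longrightarrow> (A\<^sup>\<up>)\<^sup>\<star> = A\<^sup>\<star>"
proof
  show "(A\<^sup>\<up>)\<^sup>\<star> \<subseteq> A\<^sup>\<star>"
    using below_by_trans by (fastforce simp: star_def up_iff rel_below_def)
qed (rule star_mono)

lemma star_restrict:
  assumes "A \<subseteq> A\<^sup>\<up>" "b \<in> A" "b \<lhd>[u] c"
  shows "u * b * u \<in> A\<^sup>\<star>"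
proof -
  obtain a w where "a \<in> A" "a \<lhd>[w] b" using assms(1,2) by (rule obtain_below)
  then show ?thesis using below_by_restricted_inverse[OF _ assms(3)] starI by blast
qed

lemma star_subset_up: "A \<subseteq> A\<^sup>\<up> \<Longrightarrow> A\<^sup>\<star> \<subseteq> (A\<^sup>\<star>)\<^sup>\<up>"
  by (meson star_restrict below_by_dual below_by_imp_below starE subsetI upI)

lemma subset_star_star: "A \<subseteq> A\<^sup>\<up> \<Longrightarrow> A \<subseteq> (A\<^sup>\<star>)\<^sup>\<star>"
proof
  fix c assume A: "A \<subseteq> A\<^sup>\<up>" and "c \<in> A"
  then obtain b u where "b \<in> A" "b \<lhd>[u] c" by (rule obtain_below)
  then show "c \<in> (A\<^sup>\<star>)\<^sup>\<star>" using star_restrict[OF A] below_by_dual starI by blast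
qed

lemma star_times_subset: "C\<^sup>\<star> * B\<^sup>\<star> \<subseteq> (B * C)\<^sup>\<star>"
  by (auto elim!: set_times_elim starE intro: starI[OF set_times_intro below_by_mult])


section \<open>Cosets\<close>

lemma coset_up_eq: "coset N Z C \<Longrightarrow> C\<^sup>\<up> = C"
  by (simp add: coset_def)

lemma coset_up: "coset N Z C \<Longrightarrow> a \<in> C \<Longrightarrow> a \<lhd> b \<Longrightarrow> b \<in> C"
  using coset_up_eq upI by blast

lemma coset_subset_up: "coset N Z C \<Longrightarrow> C \<subseteq> C\<^sup>\<up>"
  by (simp add: coset_up_eq)

lemma coset_below:
  assumes "coset N Z C" "c \<in> C"
  obtains a u where "a \<in> C" "a \<lhd>[u] c"
  using coset_subset_up[OF assms(1)] assms(2) by (rule obtain_below)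

lemma coset_mult3: "\<lbrakk>coset N Z C; a \<in> C; s \<in> C\<^sup>\<star>; b \<in> C\<rbrakk> \<Longrightarrow> a * s * b \<in> C"
  unfolding coset_def by (meson set_times_intro subsetD)

text \<open>To multiply three elements of \<open>A\<^sup>\<up>\<close>, \<open>A\<^sup>\<star>\<close> and \<open>A\<^sup>\<up>\<close>, replace each by an element below it.\<close>

lemma coset_upI:
  assumes A: "A \<subseteq> A\<^sup>\<up>" and mult3: "\<And>a s b. \<lbrakk>a \<in> A; s \<in> A\<^sup>\<star>; b \<in> A\<rbrakk> \<Longrightarrow> a * s * b \<in> A\<^sup>\<up>"
  shows "coset N Z (A\<^sup>\<up>)"
proof -
  have "A * A\<^sup>\<star> * A \<subseteq> A\<^sup>\<up>" by (auto elim!: set_times_elim intro: mult3)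
  then have "(A * A\<^sup>\<star> * A)\<^sup>\<up> \<subseteq> A\<^sup>\<up>" using up_mono up_up by blast
  moreover have "A\<^sup>\<up> * A\<^sup>\<star> * A\<^sup>\<up> \<subseteq> A\<^sup>\<up> * (A\<^sup>\<star>)\<^sup>\<up> * A\<^sup>\<up>"
    using star_subset_up[OF A] by (intro set_times_mono2) auto
  moreover have "A\<^sup>\<up> * (A\<^sup>\<star>)\<^sup>\<up> * A\<^sup>\<up> \<subseteq> (A * A\<^sup>\<star> * A)\<^sup>\<up>"
    by (meson order_trans set_times_mono2 subset_refl up_times_up)
  ultimately show ?thesis
    by (auto simp: coset_def star_up[OF A] up_up_eq[OF A])
qed

lemma coset_star_up:
  assumes C: "coset N Z C" and "s \<in> C\<^sup>\<star>" and st: "s \<lhd>[r] t"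
  shows "t \<in> C\<^sup>\<star>" "r \<in> C"
proof -
  obtain a b where a: "a \<in> C" and ab: "a \<lhd>[s] b" using assms(2) by (rule starE)
  have b: "b \<in> C" using C a ab coset_up below_by_imp_below by blast
  have "s * r * s \<in> C\<^sup>\<star>" using a below_by_correction[OF ab st] by (rule starI)
  then have "a * s * r \<in> C" using coset_mult3[OF C a _ b] correction_eq[OF ab st] by metis
  then show "t \<in> C\<^sup>\<star>" "r \<in> C"
    using below_by_corrected[OF ab st] starI coset_up[OF C] below_by_imp_below by blast+
qed

lemma coset_star_star:
  assumes "coset N Z C"
  shows "(C\<^sup>\<star>)\<^sup>\<star> = C"
proof
  show "(C\<^sup>\<star>)\<^sup>\<star> \<subseteq> C" using coset_star_up(2)[OF assms] by (auto elim: starE)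
qed (rule subset_star_star[OF coset_subset_up[OF assms]])

lemma coset_star:
  assumes C: "coset N Z C"
  shows "coset N Z (C\<^sup>\<star>)"
proof -
  have up: "(C\<^sup>\<star>)\<^sup>\<up> = C\<^sup>\<star>"
    using coset_star_up(1)[OF C] star_subset_up[OF coset_subset_up[OF C]]
    by (auto simp: up_iff rel_below_def)
  have "s * c * t \<in> C\<^sup>\<star>" if s: "s \<in> C\<^sup>\<star>" and c: "c \<in> C" and t: "t \<in> C\<^sup>\<star>" for s c t
  proof -
    obtain a b where a: "a \<in> C" "a \<lhd>[s] b" using s by (rule starE)
    obtain a' b' where a': "a' \<in> C" "a' \<lhd>[t] b'" using t by (rule starE)
    obtain v y where v: "v \<in> C\<^sup>\<star>" "v \<lhd>[c] y" using c coset_star_star[OF C] by (metis starE)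
    have "a' * v * a \<lhd>[s * (c * t)] b' * y * b"
      by (intro below_by_mult a a' v)
    then show ?thesis using coset_mult3[OF C a'(1) v(1) a(1)] starI by (metis mult.assoc)
  qed
  then show ?thesis
    by (auto simp: coset_def up coset_star_star[OF C] elim!: set_times_elim)
qed

lemma coset_up_triple:
  assumes C: "coset N Z C"
  shows "(C * C\<^sup>\<star> * C)\<^sup>\<up> = C"
proof
  show "(C * C\<^sup>\<star> * C)\<^sup>\<up> \<subseteq> C"
    using C up_mono[of "C * C\<^sup>\<star> * C" C] by (simp add: coset_def)
  show "C \<subseteq> (C * C\<^sup>\<star> * C)\<^sup>\<up>"
  proof
    fix c assume c: "c \<in> C"
    then obtain a u where a: "a \<in> C" "a \<lhd>[u] c" using C coset_below by blast
    then have "a * u * c \<in> C * C\<^sup>\<star> * C" using c by (intro set_times_intro starI)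
    then show "c \<in> (C * C\<^sup>\<star> * C)\<^sup>\<up>" using a below_byD(1) below_by_imp_below upI by metis
  qed
qed

lemma coset_times_source:
  assumes C: "coset N Z C" and "b \<in> C" "e \<in> (C\<^sup>\<star> * C)\<^sup>\<up>"
  shows "b * e \<in> C"
proof -
  have "C * (C\<^sup>\<star> * C)\<^sup>\<up> \<subseteq> (C * (C\<^sup>\<star> * C))\<^sup>\<up>"
    using up_times_up[of C] coset_up_eq[OF C] by simp
  then show ?thesis using coset_up_triple[OF C] assms set_times_intro by (metis mult.assoc subsetD)
qed

lemma coset_range_times:
  assumes C: "coset N Z C" and "b \<in> C" "e \<in> (C * C\<^sup>\<star>)\<^sup>\<up>"
  shows "e * b \<in> C"
proof -
  have "(C * C\<^sup>\<star>)\<^sup>\<up> * C \<subseteq> (C * C\<^sup>\<star> * C)\<^sup>\<up>"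
    using up_times_up[of _ C] coset_up_eq[OF C] by metis
  then show ?thesis using coset_up_triple[OF C] assms set_times_intro by (metis subsetD)
qed

end

locale composable_cosets = structured_semigroup +
  fixes B C :: "'a set"
  assumes B: "coset N Z B" and C: "coset N Z C"
    and match: "up_closure N Z (star N Z B * B) = up_closure N Z (C * star N Z C)"
begin

lemmas B_star = coset_star[OF B] and C_star = coset_star[OF C]

lemma composable_cosets_star: "composable_cosets N Z (C\<^sup>\<star>) (B\<^sup>\<star>)"
  by unfold_locales (simp_all add: B_star C_star coset_star_star B C match)

lemma left_times_range: "b \<in> B \<Longrightarrow> e \<in> C * C\<^sup>\<star> \<Longrightarrow> b * e \<in> B"
  using coset_times_source[OF B] match
    times_subset_up[OF coset_subset_up[OF C] coset_subset_up[OF C_star]] by auto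

lemma source_times_right: "c \<in> C \<Longrightarrow> e \<in> B\<^sup>\<star> * B \<Longrightarrow> e * c \<in> C"
  using coset_range_times[OF C] match
    times_subset_up[OF coset_subset_up[OF B_star] coset_subset_up[OF B]] by auto

lemma range_times_left_star: "s \<in> B\<^sup>\<star> \<Longrightarrow> e \<in> C * C\<^sup>\<star> \<Longrightarrow> e * s \<in> B\<^sup>\<star>"
  using coset_range_times[OF B_star] match coset_star_star[OF B]
    times_subset_up[OF coset_subset_up[OF C] coset_subset_up[OF C_star]] by auto

lemma times_subset: "B * C \<subseteq> (B * C)\<^sup>\<up>"
  by (intro times_subset_up coset_subset_up B C)

text \<open>An inverse \<open>s\<close> of the product \<open>b * c\<close> yields the inverses \<open>c * s\<close> of an element of \<open>B\<close>
  and \<open>s * b\<close> of an element of \<open>C\<close>. For an arbitrary element of \<open>C\<close> in place of \<open>c\<close>, write the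
  restriction of \<open>s\<close> as \<open>(s * b') * (c' * s)\<close>: this turns its product with \<open>C\<close> into an element of
  \<open>C * C\<^sup>\<star> * B\<^sup>\<star>\<close>.\<close>

lemma right_times_star:
  assumes c1: "c1 \<in> C" and s: "s \<in> (B * C)\<^sup>\<star>"
  shows "c1 * s \<in> B\<^sup>\<star>"
proof -
  obtain x y where x: "x \<in> B * C" "x \<lhd>[s] y" using s by (rule starE)
  then obtain b c where b: "b \<in> B" and c: "c \<in> C" and bc: "b * c \<lhd>[s] y"
    by (auto elim: set_times_elim)
  obtain b' t where b': "b' \<in> B" "b' \<lhd>[t] b" using B b by (rule coset_below)
  obtain c' u where c': "c' \<in> C" "c' \<lhd>[u] c" using C c by (rule coset_below)
  obtain b2 t2 where b2: "b2 \<in> B" "b2 \<lhd>[t2] b'" using B b'(1) by (rule coset_below)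
  obtain c2 u2 where c2: "c2 \<in> C" "c2 \<lhd>[u2] c'" using C c'(1) by (rule coset_below)
  have bc': "b' * c' \<lhd>[s] y" by (rule below_by_trans[OF below_by_mult[OF b'(2) c'(2)] bc])
  have "b2 * c2 * u2 \<in> B"
    using left_times_range[OF b2(1) set_times_intro[OF c2(1) starI[OF c2]]] by (simp add: mult.assoc)
  then have cs: "c' * s \<in> B\<^sup>\<star>"
    using below_by_cancel_right[OF bc' b2(2) c2(2)] by (rule starI)
  have "t2 * (b2 * c2) \<in> C"
    using source_times_right[OF c2(1) set_times_intro[OF starI[OF b2] b2(1)]]
    by (simp add: mult.assoc)
  then have sb: "s * b' \<in> C\<^sup>\<star>"
    using below_by_cancel_left[OF bc' b2(2) c2(2)] by (rule starI)
  obtain c0 v where c0: "c0 \<in> C" "c0 \<lhd>[v] c1" using C c1 by (rule coset_below)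
  have "c0 * (s * b') * (c' * s) \<in> B\<^sup>\<star>"
    using range_times_left_star[OF cs set_times_intro[OF c0(1) sb]] .
  moreover have "c0 * (s * (b' * c') * s) \<lhd> c1 * s"
    using below_mult[OF below_by_imp_below[OF c0(2)] below_by_imp_below[OF below_by_dual[OF bc']]] .
  ultimately show ?thesis using coset_up[OF B_star] by (simp add: mult.assoc)
qed

lemma coset_product: "coset N Z ((B * C)\<^sup>\<up>)"
proof (rule coset_upI[OF times_subset])
  fix x s y assume "x \<in> B * C" and s: "s \<in> (B * C)\<^sup>\<star>" and "y \<in> B * C"
  then obtain b1 c1 b2 c2 where x: "x = b1 * c1" "b1 \<in> B" "c1 \<in> C"
    and y: "y = b2 * c2" "b2 \<in> B" "c2 \<in> C" by (auto elim!: set_times_elim)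
  have "b1 * (c1 * s) * b2 \<in> B" using coset_mult3[OF B x(2) right_times_star[OF x(3) s] y(2)] .
  then have "b1 * (c1 * s) * b2 * c2 \<in> B * C" using y(3) by (rule set_times_intro)
  then show "x * s * y \<in> (B * C)\<^sup>\<up>" using times_subset x(1) y(1) by (auto simp: mult.assoc)
qed

text \<open>Both sides are cosets, and the right one lies in the left one; the reverse inclusion is the same
  statement for the pair \<open>C\<^sup>\<star>\<close>, \<open>B\<^sup>\<star>\<close> after taking inverses.\<close>

lemma star_product: "((B * C)\<^sup>\<up>)\<^sup>\<star> = (C\<^sup>\<star> * B\<^sup>\<star>)\<^sup>\<up>"
proof
  interpret s: composable_cosets N Z "C\<^sup>\<star>" "B\<^sup>\<star>" by (rule composable_cosets_star)
  have 1: "(C\<^sup>\<star> * B\<^sup>\<star>)\<^sup>\<up> \<subseteq> ((B * C)\<^sup>\<up>)\<^sup>\<star>"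
    using up_mono[OF star_times_subset[of C B]] coset_up_eq[OF coset_star[OF coset_product]]
    by (simp add: star_up[OF times_subset])
  then show "(C\<^sup>\<star> * B\<^sup>\<star>)\<^sup>\<up> \<subseteq> ((B * C)\<^sup>\<up>)\<^sup>\<star>" .
  have "(B * C)\<^sup>\<up> \<subseteq> ((C\<^sup>\<star> * B\<^sup>\<star>)\<^sup>\<up>)\<^sup>\<star>"
    using up_mono[OF star_times_subset[of "B\<^sup>\<star>" "C\<^sup>\<star>"]] coset_up_eq[OF coset_star[OF s.coset_product]]
    by (simp add: star_up[OF s.times_subset] coset_star_star B C)
  from star_mono[OF this] show "((B * C)\<^sup>\<up>)\<^sup>\<star> \<subseteq> (C\<^sup>\<star> * B\<^sup>\<star>)\<^sup>\<up>"
    using coset_star_star[OF s.coset_product] by simp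
qed

lemma source_product: "(((B * C)\<^sup>\<up>)\<^sup>\<star> * (B * C)\<^sup>\<up>)\<^sup>\<up> = (C\<^sup>\<star> * C)\<^sup>\<up>"
proof -
  note sub = coset_subset_up[OF B] coset_subset_up[OF C] coset_subset_up[OF B_star]
    coset_subset_up[OF C_star]
  have "(((B * C)\<^sup>\<up>)\<^sup>\<star> * (B * C)\<^sup>\<up>)\<^sup>\<up> = (C\<^sup>\<star> * B\<^sup>\<star> * (B * C))\<^sup>\<up>"
    unfolding star_product
    by (simp add: up_up_times up_times_up_right up_up_eq times_subset_up sub)
  also have "\<dots> = (C\<^sup>\<star> * (B\<^sup>\<star> * B)\<^sup>\<up> * C)\<^sup>\<up>"
    by (simp add: up_times_up_times times_subset_up sub) (simp add: mult.assoc)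
  also have "\<dots> = (C\<^sup>\<star> * (C * C\<^sup>\<star>) * C)\<^sup>\<up>"
    unfolding match by (simp add: up_times_up_times times_subset_up sub)
  also have "\<dots> = (C\<^sup>\<star> * C * C\<^sup>\<star> * C)\<^sup>\<up>" by (simp add: mult.assoc)
  also have "\<dots> = ((C\<^sup>\<star> * C * C\<^sup>\<star>)\<^sup>\<up> * C)\<^sup>\<up>"
    by (intro up_up_times[symmetric] times_subset_up sub)
  also have "\<dots> = (C\<^sup>\<star> * C)\<^sup>\<up>"
    using coset_up_triple[OF C_star] by (simp add: coset_star_star C)
  finally show ?thesis .
qed

end


section \<open>The groupoid of cosets\<close>

context structured_semigroup
begin

lemma composable_cosetsI:
  "\<lbrakk>coset N Z B; coset N Z C; (B\<^sup>\<star> * B)\<^sup>\<up> = (C * C\<^sup>\<star>)\<^sup>\<up>\<rbrakk> \<Longrightarrow> composable_cosets N Z B C"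
  by unfold_locales

lemma composable_star_left: "coset N Z C \<Longrightarrow> composable_cosets N Z (C\<^sup>\<star>) C"
  by (intro composable_cosetsI) (simp_all add: coset_star coset_star_star)

lemma source_coset: "coset N Z C \<Longrightarrow> coset N Z ((C\<^sup>\<star> * C)\<^sup>\<up>)"
  using composable_cosets.coset_product[OF composable_star_left] .

lemma star_source: "coset N Z C \<Longrightarrow> ((C\<^sup>\<star> * C)\<^sup>\<up>)\<^sup>\<star> = (C\<^sup>\<star> * C)\<^sup>\<up>"
  using composable_cosets.star_product[OF composable_star_left] by (simp add: coset_star_star)

lemma source_idem:
  assumes C: "coset N Z C"
  shows "((C\<^sup>\<star> * C)\<^sup>\<up> * (C\<^sup>\<star> * C)\<^sup>\<up>)\<^sup>\<up> = (C\<^sup>\<star> * C)\<^sup>\<up>"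
  using composable_cosets.source_product[OF composable_star_left[OF C]] by (simp add: star_source C)

lemma times_source:
  assumes C: "coset N Z C"
  shows "(C * (C\<^sup>\<star> * C)\<^sup>\<up>)\<^sup>\<up> = C"
  using coset_up_triple[OF C] C coset_star[OF C]
  by (subst up_times_up_right) (simp_all add: coset_subset_up times_subset_up mult.assoc)

lemma arrows_coset_groupoid [simp]: "arrows (coset_groupoid N Z) = cosets N Z"
  and src_coset_groupoid [simp]: "src (coset_groupoid N Z) C = (C\<^sup>\<star> * C)\<^sup>\<up>"
  and rng_coset_groupoid [simp]: "rng (coset_groupoid N Z) C = (C * C\<^sup>\<star>)\<^sup>\<up>"
  and gmult_coset_groupoid [simp]: "gmult (coset_groupoid N Z) B C = (B * C)\<^sup>\<up>"
  and ginv_coset_groupoid [simp]: "ginv (coset_groupoid N Z) C = C\<^sup>\<star>"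
  by (simp_all add: coset_groupoid_def)

lemma cosets_iff: "C \<in> cosets N Z \<longleftrightarrow> coset N Z C \<and> C \<noteq> {}"
  by (simp add: cosets_def)

lemma composableD:
  assumes "(B, C) \<in> composable (coset_groupoid N Z)"
  shows "composable_cosets N Z B C" "B \<in> cosets N Z" "C \<in> cosets N Z"
  using assms by (auto simp: composable_def cosets_iff intro: composable_cosetsI)

lemma star_in_cosets:
  assumes "C \<in> cosets N Z"
  shows "C\<^sup>\<star> \<in> cosets N Z"
proof -
  obtain c where C: "coset N Z C" and "c \<in> C" using assms by (auto simp: cosets_iff)
  then obtain a u where "a \<in> C" "a \<lhd>[u] c" using coset_below by blast
  then have "u \<in> C\<^sup>\<star>" by (rule starI)
  then show ?thesis using coset_star[OF C] by (auto simp: cosets_iff)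
qed

lemma product_in_cosets:
  assumes "(B, C) \<in> composable (coset_groupoid N Z)"
  shows "(B * C)\<^sup>\<up> \<in> cosets N Z"
proof -
  interpret composable_cosets N Z B C by (rule composableD[OF assms])
  have "B * C \<noteq> {}" using composableD(2,3)[OF assms] by (auto simp: cosets_iff set_times_def)
  then show ?thesis using coset_product times_subset by (auto simp: cosets_iff)
qed

lemma groupoid_cosets: "groupoid (coset_groupoid N Z)"
proof -
  have s: "(C\<^sup>\<star> * C)\<^sup>\<up> \<in> cosets N Z" if "C \<in> cosets N Z" for C
    using that star_in_cosets[OF that]
    by (intro product_in_cosets) (auto simp: composable_def cosets_iff coset_star_star)
  have r: "(C * C\<^sup>\<star>)\<^sup>\<up> \<in> cosets N Z" if "C \<in> cosets N Z" for C
    using s[OF star_in_cosets[OF that]] that by (simp add: cosets_iff coset_star_star)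
  show ?thesis
  proof (unfold_locales, unfold arrows_coset_groupoid src_coset_groupoid rng_coset_groupoid
      gmult_coset_groupoid ginv_coset_groupoid)
    fix C assume "C \<in> cosets N Z"
    then have C: "coset N Z C" and C': "coset N Z (C\<^sup>\<star>)" by (auto simp: cosets_iff coset_star)
    show "(((C\<^sup>\<star> * C)\<^sup>\<up>)\<^sup>\<star> * (C\<^sup>\<star> * C)\<^sup>\<up>)\<^sup>\<up> = (C\<^sup>\<star> * C)\<^sup>\<up>"
      "((C\<^sup>\<star> * C)\<^sup>\<up> * ((C\<^sup>\<star> * C)\<^sup>\<up>)\<^sup>\<star>)\<^sup>\<up> = (C\<^sup>\<star> * C)\<^sup>\<up>"
      using star_source[OF C] source_idem[OF C] by simp_all
    show "(((C * C\<^sup>\<star>)\<^sup>\<up>)\<^sup>\<star> * (C * C\<^sup>\<star>)\<^sup>\<up>)\<^sup>\<up> = (C * C\<^sup>\<star>)\<^sup>\<up>"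
      "((C * C\<^sup>\<star>)\<^sup>\<up> * ((C * C\<^sup>\<star>)\<^sup>\<up>)\<^sup>\<star>)\<^sup>\<up> = (C * C\<^sup>\<star>)\<^sup>\<up>"
      using star_source[OF C'] source_idem[OF C'] by (simp_all add: coset_star_star C)
    show "(C * (C\<^sup>\<star> * C)\<^sup>\<up>)\<^sup>\<up> = C" by (rule times_source[OF C])
    show "((C * C\<^sup>\<star>)\<^sup>\<up> * C)\<^sup>\<up> = C"
      using coset_up_triple[OF C] C C'
      by (simp add: up_up_times coset_subset_up times_subset_up)
    show "((C\<^sup>\<star>)\<^sup>\<star> * C\<^sup>\<star>)\<^sup>\<up> = (C * C\<^sup>\<star>)\<^sup>\<up>" "(C\<^sup>\<star> * (C\<^sup>\<star>)\<^sup>\<star>)\<^sup>\<up> = (C\<^sup>\<star> * C)\<^sup>\<up>"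
      by (simp_all add: coset_star_star C)
  next
    fix B C assume BC: "(B, C) \<in> composable (coset_groupoid N Z)"
    interpret composable_cosets N Z B C by (rule composableD[OF BC])
    interpret i: composable_cosets N Z "C\<^sup>\<star>" "B\<^sup>\<star>" by (rule composable_cosets_star)
    show "(((B * C)\<^sup>\<up>)\<^sup>\<star> * (B * C)\<^sup>\<up>)\<^sup>\<up> = (C\<^sup>\<star> * C)\<^sup>\<up>" by (rule source_product)
    show "((B * C)\<^sup>\<up> * ((B * C)\<^sup>\<up>)\<^sup>\<star>)\<^sup>\<up> = (B * B\<^sup>\<star>)\<^sup>\<up>"
      using i.source_product star_product coset_star_star[OF coset_product]
      by (simp add: coset_star_star B)
  next
    fix A B C assume "(A, B) \<in> composable (coset_groupoid N Z)"
      "(B, C) \<in> composable (coset_groupoid N Z)"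
    then have "A \<subseteq> A\<^sup>\<up>" "B \<subseteq> B\<^sup>\<up>" "C \<subseteq> C\<^sup>\<up>"
      by (auto simp: composable_def cosets_iff coset_up_eq)
    then show "((A * B)\<^sup>\<up> * C)\<^sup>\<up> = (A * (B * C)\<^sup>\<up>)\<^sup>\<up>"
      by (simp add: up_up_times up_times_up_right times_subset_up mult.assoc)
  qed (use s r star_in_cosets product_in_cosets in auto)
qed


section \<open>The topology on cosets\<close>

lemma topspace_cosets: "topspace (coset_topology N Z) = cosets N Z"
proof
  show "topspace (coset_topology N Z) \<subseteq> cosets N Z"
    by (auto simp: coset_topology_def topology_generated_by_topspace)
  show "cosets N Z \<subseteq> topspace (coset_topology N Z)"
    unfolding coset_topology_def topology_generated_by_topspace
  proof
    fix C assume C: "C \<in> cosets N Z"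
    then obtain a where "a \<in> C" by (auto simp: cosets_iff)
    then show "C \<in> \<Union>{{C \<in> cosets N Z. a \<in> C} |a. True}" using C by blast
  qed
qed

lemma openin_cosets_containing: "openin (coset_topology N Z) {C \<in> cosets N Z. a \<in> C}"
  unfolding coset_topology_def by (rule topology_generated_by_Basis) auto

lemma openin_cosets_containing_finite:
  "finite F \<Longrightarrow> openin (coset_topology N Z) {C \<in> cosets N Z. F \<subseteq> C}"
proof (induction F rule: finite_induct)
  case empty
  then show ?case using openin_topspace[of "coset_topology N Z"] by (simp add: topspace_cosets)
next
  case (insert a F)
  have "{C \<in> cosets N Z. insert a F \<subseteq> C} = {C \<in> cosets N Z. a \<in> C} \<inter> {C \<in> cosets N Z. F \<subseteq> C}"
    by auto
  then show ?case using insert.IH openin_cosets_containing by (simp add: openin_Int)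
qed

lemma openin_cosets_finite_subset:
  assumes "openin (coset_topology N Z) U" "C \<in> U"
  obtains F where "finite F" "F \<subseteq> C" "\<And>D. D \<in> cosets N Z \<Longrightarrow> F \<subseteq> D \<Longrightarrow> D \<in> U"
proof -
  have "generate_topology_on {{C \<in> cosets N Z. a \<in> C} |a. True} U"
    using assms(1) by (simp add: coset_topology_def openin_topology_generated_by_iff)
  then have "\<exists>F. finite F \<and> F \<subseteq> C \<and> (\<forall>D\<in>cosets N Z. F \<subseteq> D \<longrightarrow> D \<in> U)"
    using assms(2)
  proof (induction rule: generate_topology_on.induct)
    case (Int V W)
    then obtain F G where "finite F" "F \<subseteq> C" "\<forall>D\<in>cosets N Z. F \<subseteq> D \<longrightarrow> D \<in> V"
      "finite G" "G \<subseteq> C" "\<forall>D\<in>cosets N Z. G \<subseteq> D \<longrightarrow> D \<in> W" by auto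
    then show ?case by (intro exI[of _ "F \<union> G"]) auto
  next
    case (UN K)
    then obtain V where V: "V \<in> K" "C \<in> V" by auto
    with UN.IH obtain F where "finite F" "F \<subseteq> C" "\<forall>D\<in>cosets N Z. F \<subseteq> D \<longrightarrow> D \<in> V" by metis
    then show ?case using V(1) by (intro exI[of _ F]) auto
  next
    case (Basis V)
    then obtain a where "V = {C \<in> cosets N Z. a \<in> C}" by auto
    then show ?case using Basis by (intro exI[of _ "{a}"]) auto
  qed auto
  then show ?thesis using that by blast
qed

lemma continuous_map_coset_topology:
  assumes "\<And>x. x \<in> topspace X \<Longrightarrow> f x \<in> cosets N Z"
    and "\<And>a. openin X {x \<in> topspace X. a \<in> f x}"
  shows "continuous_map X (coset_topology N Z) f"
  unfolding coset_topology_def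
proof (rule continuous_on_generated_topo)
  fix U assume "U \<in> {{C \<in> cosets N Z. a \<in> C} |a. True}"
  then obtain a where "U = {C \<in> cosets N Z. a \<in> C}" by auto
  then have "f -` U \<inter> topspace X = {x \<in> topspace X. a \<in> f x}" using assms(1) by auto
  then show "openin X (f -` U \<inter> topspace X)" using assms(2) by simp
next
  show "f ` topspace X \<subseteq> \<Union>{{C \<in> cosets N Z. a \<in> C} |a. True}"
    using assms(1) topspace_cosets
    unfolding coset_topology_def topology_generated_by_topspace by blast
qed

lemma topological_groupoid_cosets:
  "topological_groupoid (coset_groupoid N Z) (coset_topology N Z)"
proof -
  let ?G = "coset_groupoid N Z" and ?T = "coset_topology N Z"
  let ?P = "subtopology (prod_topology ?T ?T) (composable ?G)"
  interpret groupoid ?G by (rule groupoid_cosets)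
  have P: "topspace ?P = composable ?G"
    by (auto simp: topspace_cosets composable_def)
  have i: "continuous_map ?T ?T (\<lambda>C. C\<^sup>\<star>)"
  proof (rule continuous_map_coset_topology)
    fix a
    have "{C \<in> topspace ?T. a \<in> C\<^sup>\<star>} = \<Union>{{C \<in> cosets N Z. c \<in> C} |c. \<exists>b. c \<lhd>[a] b}"
      by (auto simp: topspace_cosets star_def)
    then show "openin ?T {C \<in> topspace ?T. a \<in> C\<^sup>\<star>}"
      using openin_cosets_containing by auto
  qed (simp add: topspace_cosets star_in_cosets)
  have m: "continuous_map ?P ?T (\<lambda>(B, C). (B * C)\<^sup>\<up>)"
  proof (rule continuous_map_coset_topology)
    fix a
    let ?R = "\<lambda>b c. {C \<in> cosets N Z. b \<in> C} \<times> {C \<in> cosets N Z. c \<in> C}"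
    have "{x \<in> topspace ?P. a \<in> (case x of (B, C) \<Rightarrow> (B * C)\<^sup>\<up>)}
        = composable ?G \<inter> \<Union>{?R b c |b c. b * c \<lhd> a}"
      (is "?L = ?M")
    proof (intro set_eqI)
      fix x :: "'a set \<times> 'a set"
      obtain B C where x: "x = (B, C)" by (cases x)
      have "a \<in> (B * C)\<^sup>\<up> \<longleftrightarrow> (\<exists>b c. b \<in> B \<and> c \<in> C \<and> b * c \<lhd> a)"
        unfolding up_iff by (blast elim: set_times_elim)
      moreover have "x \<in> composable ?G \<Longrightarrow> B \<in> cosets N Z \<and> C \<in> cosets N Z"
        using composableD x by blast
      ultimately show "x \<in> ?L \<longleftrightarrow> x \<in> ?M" unfolding P x by auto
    qed
    moreover have "openin (prod_topology ?T ?T) (\<Union>{?R b c |b c. b * c \<lhd> a})"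
      using openin_cosets_containing by (auto simp: openin_prod_Times_iff)
    ultimately show "openin ?P {x \<in> topspace ?P. a \<in> (case x of (B, C) \<Rightarrow> (B * C)\<^sup>\<up>)}"
      by (auto simp: openin_subtopology)
  qed (use product_in_cosets P in auto)
  show ?thesis
    by unfold_locales (use i m in \<open>simp_all add: topspace_cosets coset_groupoid_def\<close>)
qed


section \<open>Open source map\<close>

text \<open>Units are the cosets that meet \<open>N\<close>: if \<open>n' \<lhd>[u] n\<close> for elements of both \<open>C\<close> and \<open>N\<close>, then
  \<open>n * u\<close> is a central element of both \<open>C\<close> and \<open>C\<^sup>\<star>\<close>. Multiplying by it moves elements of \<open>C\<close>
  down into \<open>C\<^sup>\<star> * C\<close> and conversely.\<close>

lemma coset_meets_N_unit:
  assumes C: "coset N Z C" and n: "n \<in> C" "n \<in> N"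
  shows "(C\<^sup>\<star> * C)\<^sup>\<up> = C"
proof
  note C' = coset_star[OF C]
  obtain n' u where n': "n' \<in> C" "n' \<lhd>[u] n" using C n(1) by (rule coset_below)
  note d = below_byD[OF n'(2)] below_byD_assoc[OF n'(2)]
  define z where "z = n * u"
  have z: "z \<in> Z" using d by (simp add: z_def)
  have zn': "z * n' = n'" using d by (simp add: z_def)
  have n'N: "n' \<in> N" using N_mult[of "n' * u" n] d n(2) by simp
  have n'z: "n' * z = n'" using NZ_commute[OF n'N z] zn' by simp
  have below: "n' \<lhd>[z] z"
    by (rule below_byI) (simp_all add: n'z zn' n'N z Z_mult mult.assoc)
  have zC: "z \<in> C" using coset_up[OF C n'(1)] below_by_imp_below[OF below] .
  have zC': "z \<in> C\<^sup>\<star>" using n'(1) below by (rule starI)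
  show "C \<subseteq> (C\<^sup>\<star> * C)\<^sup>\<up>"
  proof
    fix c assume "c \<in> C"
    then obtain c' s where c': "c' \<in> C" "c' \<lhd>[s] c" using C coset_below by blast
    have "z * c' \<lhd> c" using below_N_left[OF below_by_imp_below[OF c'(2)] Z_imp_N[OF z]] .
    then show "c \<in> (C\<^sup>\<star> * C)\<^sup>\<up>" using zC' c'(1) by (intro upI[OF set_times_intro])
  qed
  show "(C\<^sup>\<star> * C)\<^sup>\<up> \<subseteq> C"
  proof
    fix x assume "x \<in> (C\<^sup>\<star> * C)\<^sup>\<up>"
    then obtain s c where s: "s \<in> C\<^sup>\<star>" "c \<in> C" "s * c \<lhd> x"
      by (auto simp: up_iff elim!: set_times_elim)
    have "z * s * c \<in> C" using coset_mult3[OF C zC s(1,2)] .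
    moreover have "z * s * c \<lhd> x"
      using below_N_left[OF s(3) Z_imp_N[OF z]] by (simp add: mult.assoc)
    ultimately show "x \<in> C" by (rule coset_up[OF C])
  qed
qed

text \<open>The local inverse of the source map: from a unit \<open>F\<close> containing \<open>u * c'\<close>, where \<open>c' \<lhd>[u] c\<close>,
  one recovers the coset through \<open>c\<close> with source \<open>F\<close> as the upward closure of \<open>c * F\<close>.\<close>

lemma coset_with_source:
  assumes F: "coset N Z F" and star: "F\<^sup>\<star> = F" and FF: "F * F \<subseteq> F"
    and c: "c' \<lhd>[u] c" and uc: "u * c' \<in> F"
  defines "D \<equiv> ({c} * F)\<^sup>\<up>"
  shows "D \<in> cosets N Z" "(D\<^sup>\<star> * D)\<^sup>\<up> = F" "{c} * F \<subseteq> D"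
proof -
  note d = below_byD[OF c] below_byD_assoc[OF c]
  have times: "x * y \<in> F" if "x \<in> F" "y \<in> F" for x y using FF that by auto
  have sub: "{c} * F \<subseteq> ({c} * F)\<^sup>\<up>"
  proof
    fix x assume "x \<in> {c} * F"
    then obtain f where f: "x = c * f" "f \<in> F" by (auto elim: set_times_elim)
    obtain f' s where f': "f' \<in> F" "f' \<lhd>[s] f" using F f(2) by (rule coset_below)
    have "c * (u * c' * f') \<in> {c} * F" using times[OF uc f'(1)] by (intro set_times_intro) auto
    moreover have "c * (u * c' * f') \<lhd> x"
      using below_mult[OF below_by_imp_below[OF c] below_by_imp_below[OF f'(2)]] d f(1)
      by (simp add: mult.assoc)
    ultimately show "x \<in> ({c} * F)\<^sup>\<up>" by (rule upI)
  qed
  then show cF: "{c} * F \<subseteq> D" by (simp add: D_def)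
  have sc: "s * c \<in> F" if s: "s \<in> ({c} * F)\<^sup>\<star>" for s
  proof -
    obtain x y where x: "x \<in> {c} * F" "x \<lhd>[s] y" using s by (rule starE)
    then obtain f where f: "f \<in> F" "c * f \<lhd>[s] y" by (auto elim: set_times_elim)
    obtain f' v where f': "f' \<in> F" "f' \<lhd>[v] f" using F f(1) by (rule coset_below)
    have "u * (c' * f') \<in> F" using times[OF uc f'(1)] by (simp add: mult.assoc)
    then have "s * c \<in> F\<^sup>\<star>" using below_by_cancel_left[OF f(2) c f'(2)] by (rule starI)
    then show ?thesis by (simp add: star)
  qed
  have D: "coset N Z D"
    unfolding D_def
  proof (rule coset_upI[OF sub])
    fix a s b assume "a \<in> {c} * F" and s: "s \<in> ({c} * F)\<^sup>\<star>" and "b \<in> {c} * F"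
    then obtain f g where fg: "a = c * f" "f \<in> F" "b = c * g" "g \<in> F" by (auto elim!: set_times_elim)
    have "a * s * b = c * (f * (s * c) * g)" by (simp add: fg mult.assoc)
    moreover have "f * (s * c) * g \<in> F" using times sc[OF s] fg(2,4) by blast
    ultimately have "a * s * b \<in> {c} * F" by auto
    then show "a * s * b \<in> ({c} * F)\<^sup>\<up>" using sub by blast
  qed
  have c'D: "c' \<in> {c} * F"
    using set_times_intro[OF singletonI uc, of c] d by (simp add: mult.assoc)
  then show "D \<in> cosets N Z" using D cF by (auto simp: cosets_iff)
  have star_D: "D\<^sup>\<star> = ({c} * F)\<^sup>\<star>" using star_up[OF sub] by (simp add: D_def)
  have src: "(D\<^sup>\<star> * D)\<^sup>\<up> = (({c} * F)\<^sup>\<star> * ({c} * F))\<^sup>\<up>"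
    unfolding star_D using sub by (simp add: D_def up_times_up_right star_subset_up)
  have "s * (c * f) \<in> F" if "s \<in> ({c} * F)\<^sup>\<star>" "f \<in> F" for s f
    using times[OF sc[OF that(1)] that(2)] by (simp add: mult.assoc)
  then have "({c} * F)\<^sup>\<star> * ({c} * F) \<subseteq> F" by (auto elim!: set_times_elim)
  then have 1: "(D\<^sup>\<star> * D)\<^sup>\<up> \<subseteq> F" unfolding src using up_mono coset_up_eq[OF F] by metis
  have "F \<subseteq> (D\<^sup>\<star> * D)\<^sup>\<up>"
  proof
    fix f assume "f \<in> F"
    then obtain f' s where f': "f' \<in> F" "f' \<lhd>[s] f" using F coset_below by blast
    have "u \<in> D\<^sup>\<star>" unfolding star_D using c'D c by (rule starI)
    moreover have "c * f' \<in> D" using cF f'(1) by auto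
    moreover have "u * (c * f') \<lhd> f"
      using below_N_left[OF below_by_imp_below[OF f'(2)], of "u * c"] d Z_imp_N
      by (simp add: mult.assoc)
    ultimately show "f \<in> (D\<^sup>\<star> * D)\<^sup>\<up>" by (intro upI[OF set_times_intro])
  qed
  then show "(D\<^sup>\<star> * D)\<^sup>\<up> = F" using 1 by blast
qed

text \<open>A neighbourhood of \<open>C\<close> is given by finitely many \<open>a \<in> C\<close>. Choose \<open>c' \<lhd>[u] c\<close> in \<open>C\<close>, and for
  every \<open>a\<close> some \<open>a' \<in> C\<close> below it. Then \<open>c * (u * c' * u * a') = c' * u * a'\<close> is below \<open>a\<close>;
  since
  \<open>u * c'\<close> is in \<open>N\<close>, a coset containing it and all the \<open>u * c' * u * a'\<close> is a unit and the source
  of a coset containing every \<open>a\<close>.\<close>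

lemma open_source: "open_map (coset_topology N Z) (coset_topology N Z) (\<lambda>C. (C\<^sup>\<star> * C)\<^sup>\<up>)"
  unfolding open_map_def
proof (intro allI impI)
  fix U assume U: "openin (coset_topology N Z) U"
  have "\<exists>W. openin (coset_topology N Z) W \<and> (C\<^sup>\<star> * C)\<^sup>\<up> \<in> W \<and> W \<subseteq> (\<lambda>C. (C\<^sup>\<star> * C)\<^sup>\<up>) ` U"
    if CU: "C \<in> U" for C
  proof -
    have "C \<in> cosets N Z" using U CU openin_subset topspace_cosets by blast
    then have C: "coset N Z C" and "C \<noteq> {}" by (auto simp: cosets_iff)
    then obtain c c' u where c: "c' \<in> C" "c' \<lhd>[u] c" using coset_below by (metis all_not_in_conv)
    note d = below_byD[OF c(2)] below_byD_assoc[OF c(2)]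
    obtain A where A: "finite A" "A \<subseteq> C" "\<And>D. D \<in> cosets N Z \<Longrightarrow> A \<subseteq> D \<Longrightarrow> D \<in> U"
      using openin_cosets_finite_subset[OF U CU] by blast
    have "\<forall>a\<in>A. \<exists>a'. a' \<in> C \<and> a' \<lhd> a"
      using A(2) coset_below[OF C] below_by_imp_below by (metis subsetD)
    then obtain p where p: "\<And>a. a \<in> A \<Longrightarrow> p a \<in> C \<and> p a \<lhd> a" by metis
    define K where "K = insert (u * c') ((\<lambda>a. u * c' * u * p a) ` A)"
    define W where "W = {F \<in> cosets N Z. K \<subseteq> F}"
    have "u \<in> C\<^sup>\<star>" using c by (rule starI)
    then have "u * c' \<in> C\<^sup>\<star> * C" using c(1) by (rule set_times_intro)
    moreover have "u * c' * u * p a \<in> C\<^sup>\<star> * C" if "a \<in> A" for a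
      using star_restrict[OF coset_subset_up[OF C] c] p[OF that] by (intro set_times_intro) auto
    moreover have "C\<^sup>\<star> * C \<subseteq> (C\<^sup>\<star> * C)\<^sup>\<up>"
      by (intro times_subset_up coset_subset_up coset_star C)
    ultimately have KE: "K \<subseteq> (C\<^sup>\<star> * C)\<^sup>\<up>" unfolding K_def by blast
    then have "(C\<^sup>\<star> * C)\<^sup>\<up> \<in> W"
      using source_coset[OF C] by (auto simp: W_def cosets_iff K_def)
    moreover have "openin (coset_topology N Z) W"
      unfolding W_def using A(1) by (intro openin_cosets_containing_finite) (simp add: K_def)
    moreover have "F \<in> (\<lambda>C. (C\<^sup>\<star> * C)\<^sup>\<up>) ` U" if "F \<in> W" for F
    proof -
      have F: "coset N Z F" and uc: "u * c' \<in> F" and pF: "\<And>a. a \<in> A \<Longrightarrow> u * c' * u * p a \<in> F"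
        using that by (auto simp: W_def cosets_iff K_def)
      have unit: "(F\<^sup>\<star> * F)\<^sup>\<up> = F" using coset_meets_N_unit[OF F uc] d by simp
      then have star: "F\<^sup>\<star> = F" using star_source[OF F] by simp
      have "F * F \<subseteq> F"
        using coset_times_source[OF F] unit by (auto elim!: set_times_elim)
      note slice = coset_with_source[OF F star this c(2) uc]
      have "a \<in> ({c} * F)\<^sup>\<up>" if a: "a \<in> A" for a
      proof (rule upI)
        show "c * (u * c' * u * p a) \<in> {c} * F" using pF[OF a] by (intro set_times_intro) auto
        show "c * (u * c' * u * p a) \<lhd> a"
          using below_N_left[of "p a" a "c' * u"] p[OF a] d by (simp add: mult.assoc)
      qed
      then have "({c} * F)\<^sup>\<up> \<in> U" using A(3)[OF slice(1)] by blast
      then show ?thesis by (rule rev_image_eqI) (simp add: slice(2))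
    qed
    ultimately show ?thesis by blast
  qed
  then show "openin (coset_topology N Z) ((\<lambda>C. (C\<^sup>\<star> * C)\<^sup>\<up>) ` U)"
    unfolding openin_subopen[of _ "(\<lambda>C. (C\<^sup>\<star> * C)\<^sup>\<up>) ` U"] by simp
qed

lemma etale_groupoid_cosets: "etale_groupoid (coset_groupoid N Z) (coset_topology N Z)"
proof -
  interpret topological_groupoid "coset_groupoid N Z" "coset_topology N Z"
    by (rule topological_groupoid_cosets)
  show ?thesis
    by unfold_locales (use open_source in \<open>simp add: coset_groupoid_def\<close>)
qed


section \<open>Directed cosets\<close>

lemma directedE:
  assumes "directed N Z D" "a \<in> D" "b \<in> D"
  obtains d where "d \<in> D" "d \<lhd> a" "d \<lhd> b"
  using assms by (auto simp: directed_def)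

text \<open>Given \<open>s' \<lhd> s\<close> and \<open>t' \<lhd> t\<close> with inverses \<open>a\<close> and \<open>b\<close> in \<open>D\<close>, a common lower bound \<open>d\<close> of
  \<open>a\<close> and \<open>b\<close> has both \<open>s' * d\<close> and \<open>d * t'\<close> in \<open>N\<close>; so \<open>s' * d * t'\<close> is below \<open>s\<close> and \<open>t\<close>.\<close>

lemma directed_star:
  assumes D: "coset N Z D" and dir: "directed N Z D"
  shows "directed N Z (D\<^sup>\<star>)"
  unfolding directed_def
proof (intro ballI)
  fix s t assume s: "s \<in> D\<^sup>\<star>" and t: "t \<in> D\<^sup>\<star>"
  obtain s' p where s': "s' \<in> D\<^sup>\<star>" "s' \<lhd>[p] s" using coset_star[OF D] s by (rule coset_below)
  obtain t' q where t': "t' \<in> D\<^sup>\<star>" "t' \<lhd>[q] t" using coset_star[OF D] t by (rule coset_below)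
  obtain a x where a: "a \<in> D" "a \<lhd>[s'] x" using s'(1) by (rule starE)
  obtain b y where b: "b \<in> D" "b \<lhd>[t'] y" using t'(1) by (rule starE)
  obtain d where d: "d \<in> D" "d \<lhd> a" "d \<lhd> b" using dir a(1) b(1) by (rule directedE)
  obtain v w where "d \<lhd>[v] a" "d \<lhd>[w] b" using d(2,3) by (auto simp: rel_below_def)
  then have N: "s' * d \<in> N" "d * t' \<in> N"
    using below_byD(4)[OF below_by_trans[OF _ a(2)]] below_byD(3)[OF below_by_trans[OF _ b(2)]]
    by blast+
  have "s' * d * t' \<in> D\<^sup>\<star>"
    using coset_mult3[OF coset_star[OF D] s'(1) _ t'(1)] d(1) by (simp add: coset_star_star D)
  moreover have "s' * d * t' \<lhd> s"
    using below_N_right[OF below_by_imp_below[OF s'(2)] N(2)] by (simp add: mult.assoc)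
  moreover have "s' * d * t' \<lhd> t"
    using below_N_left[OF below_by_imp_below[OF t'(2)] N(1)] .
  ultimately show "\<exists>d\<in>D\<^sup>\<star>. d \<lhd> s \<and> d \<lhd> t" by blast
qed

text \<open>Only one of the two factors has to be directed: for \<open>b\<close> and \<open>b2\<close> in the other factor, choose
  \<open>b3 \<lhd>[s] b\<close> and move the product \<open>b2 * d2\<close> into \<open>C\<close> as \<open>s * b2 * d2\<close>. A lower bound \<open>w\<close> of this
  and \<open>c'\<close> in \<open>C\<close> gives the lower bound \<open>b3 * w\<close> in the product, because \<open>b * s\<close> is in \<open>Z\<close>.\<close>

lemma (in composable_cosets) directed_product:
  assumes dir: "directed N Z C"
  shows "directed N Z ((B * C)\<^sup>\<up>)"
  unfolding directed_def
proof (intro ballI)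
  fix x y assume "x \<in> (B * C)\<^sup>\<up>" "y \<in> (B * C)\<^sup>\<up>"
  then obtain b c b2 c2 where b: "b \<in> B" and c: "c \<in> C" and x: "b * c \<lhd> x"
    and b2: "b2 \<in> B" and c2: "c2 \<in> C" and y: "b2 * c2 \<lhd> y"
    by (auto simp: up_iff elim!: set_times_elim)
  obtain b3 s where b3: "b3 \<in> B" "b3 \<lhd>[s] b" using B b by (rule coset_below)
  have sbc: "s * b2 * c2 \<in> C"
    using source_times_right[OF c2 set_times_intro[OF starI[OF b3] b2]] .
  obtain w where w: "w \<in> C" "w \<lhd> c" "w \<lhd> s * b2 * c2" using dir c sbc by (rule directedE)
  have "b3 * w \<in> (B * C)\<^sup>\<up>" using times_subset b3(1) w(1) by auto
  moreover have "b3 * w \<lhd> x"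
    using below_trans[OF below_mult[OF below_by_imp_below[OF b3(2)] w(2)] x] .
  moreover have "b3 * w \<lhd> y"
  proof (rule below_trans)
    show "b3 * w \<lhd> b * (s * b2 * c2)" using below_mult[OF below_by_imp_below[OF b3(2)] w(3)] .
    have "b * s \<in> N" using below_byD(5)[OF b3(2)] Z_imp_N by blast
    then have "b * s * (b2 * c2) \<lhd> y" by (rule below_N_left[OF y])
    then show "b * (s * b2 * c2) \<lhd> y" by (simp add: mult.assoc)
  qed
  ultimately show "\<exists>d\<in>(B * C)\<^sup>\<up>. d \<lhd> x \<and> d \<lhd> y" by blast
qed

lemma (in composable_cosets) directed_product_left:
  assumes "directed N Z B"
  shows "directed N Z ((B * C)\<^sup>\<up>)"
proof -
  interpret s: composable_cosets N Z "C\<^sup>\<star>" "B\<^sup>\<star>" by (rule composable_cosets_star)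
  have "directed N Z (((C\<^sup>\<star> * B\<^sup>\<star>)\<^sup>\<up>)\<^sup>\<star>)"
    using directed_star[OF s.coset_product s.directed_product[OF directed_star[OF B assms]]] .
  then show ?thesis using coset_star_star[OF coset_product] by (simp add: star_product)
qed

lemma groupoid_ideal_directed_cosets: "groupoid_ideal (coset_groupoid N Z) (directed_cosets N Z)"
proof -
  interpret groupoid "coset_groupoid N Z" by (rule groupoid_cosets)
  show ?thesis
  proof
    show "directed_cosets N Z \<subseteq> arrows (coset_groupoid N Z)" by (auto simp: directed_cosets_def)
  next
    fix B C assume BC: "(B, C) \<in> composable (coset_groupoid N Z)"
      and "B \<in> directed_cosets N Z \<or> C \<in> directed_cosets N Z"
    then have "directed N Z ((B * C)\<^sup>\<up>)"
      using composable_cosets.directed_product[OF composableD(1)[OF BC]]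
        composable_cosets.directed_product_left[OF composableD(1)[OF BC]]
      unfolding directed_cosets_def by blast
    then show "gmult (coset_groupoid N Z) B C \<in> directed_cosets N Z"
      using product_in_cosets[OF BC] by (simp add: directed_cosets_def)
  qed
qed

lemma subgroupoid_directed_cosets: "subgroupoid (coset_groupoid N Z) (directed_cosets N Z)"
proof -
  interpret groupoid_ideal "coset_groupoid N Z" "directed_cosets N Z"
    by (rule groupoid_ideal_directed_cosets)
  show ?thesis
  proof
    fix D assume "D \<in> directed_cosets N Z"
    then have D: "D \<in> cosets N Z" "directed N Z D" by (auto simp: directed_cosets_def)
    then have "directed N Z (D\<^sup>\<star>)" using directed_star cosets_iff by blast
    then show "ginv (coset_groupoid N Z) D \<in> directed_cosets N Z"
      using star_in_cosets[OF D(1)] by (simp add: directed_cosets_def)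
  qed (rule ideal_subset, rule ideal_gmult, auto)
qed

end

theorem proposition11p6:
  fixes N Z :: "'a::semigroup_mult set"
  assumes "structured_semigroup N Z"
  shows "groupoid_ideal (coset_groupoid N Z) (directed_cosets N Z) \<and>
    etale_subgroupoid (coset_groupoid N Z) (coset_topology N Z) (directed_cosets N Z)"
proof -
  interpret structured_semigroup N Z by fact
  show ?thesis
    using groupoid_ideal_directed_cosets subgroupoid_directed_cosets etale_groupoid_cosets
      etale_subgroupoid_ideal by (intro conjI)
qed

end
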